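(* The tuple $\mathfrak{M}=(\mathcal{U},\mathcal{R},\mathcal{M},\bot,\top\mathtt{*},\mathtt{|},\mathtt{\&},\sim)$ is an effective Boolean algebra over $\mathcal{U}$. That is, $\mathcal{R}$ is closed under $\mathtt{|},\mathtt{\&},\sim$, the map $\mathcal{M}:\mathcal{R}\to2^{\mathcal{U}}$ satisfies $\mathcal{M}(\bot)=\emptyset$ and $\mathcal{M}(\top\mathtt{*})=\mathcal{U}$, and for all $R,S\in\mathcal{R}$: $\mathcal{M}(R\mathtt{|}S)=\mathcal{M}(R)\cup\mathcal{M}(S)$, $\mathcal{M}(R\mathtt{\&}S)=\mathcal{M}(R)\cap\mathcal{M}(S)$, and $\mathcal{M}(\sim R)=\mathcal{U}\setminus\mathcal{M}(R)$.
   Context: **Effective Boolean algebra.** An effective Boolean algebra over a set $D$ is a tuple $(D,\Psi,[\![\cdot]\!],\bot,\top,\vee,\wedge,\neg)$ where $\Psi$ is a set of predicates closed under the connectives $\vee,\wedge,\neg$, $[\![\cdot]\!]:\Psi\to 2^D$ is a denotation function, $\bot,\top\in\Psi$, $[\![\bot]\!]=\emptyset$, $[\![\top]\!]=D$, and for all $\varphi,\psi\in\Psi$: $[\![\varphi\vee\psi]\!]=[\![\varphi]\!]\cup[\![\psi]\!]$, $[\![\varphi\wedge\psi]\!]=[\![\varphi]\!]\cap[\![\psi]\!]$, $[\![\neg\varphi]\!]=D\setminus[\![\varphi]\!]$. **Alphabet.** $\Sigma$ is a domain of characters, and $(\Sigma,\Psi,[\![\cdot]\!],\bot,\top,\vee,\wedge,\neg)$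 is a fixed effective Boolean algebra over $\Sigma$. **Strings and locations.** For $s\in\Sigma^*$, $|s|$ is its length, $s_i$ ($0\le i<|s|$) its $i$-th character (indexing from 0), and $s_{-1}=s_{|s|}=\epsilon$ (the empty string, which belongs to no $[\![\psi]\!]$). $s^r$ is the reverse of $s$. A location in $s$ is a pair $s\langle i\rangle=\langle s,i\rangle$ with $-1\le i\le|s|$; it is valid if $0\le i\le|s|$ and final if $i=|s|$. Locations are ordered by position: $s\langle i\rangle<s\langle j\rangle$ iff $i<j$; $s\langle i\rangle+1=s\langle i+1\rangle$. The reverse of a valid location is $s\langle i\rangle^r=s^r\langle|s|-i\rangle$. The match failure is $\mathsf{fail}=\epsilon\langle-1\rangle$, and $\max(x,\mathsf{fail})=\max(\mathsf{fail},x)=x$. **Regexes.** $\mathcal{R}$ is generated by $$R::=\psi\mid()\mid R\,\mathtt{|}\,R'\mid R\,\mathtt{\&}\,R'\mid R\cdot R'\mid R\{m,n\}\mid\ \sim R\mid\mathtt{(?=}R\mathtt{)}\mid\mathtt{(?<=}R\mathtt{)}\mid\mathtt{(?!}R\mathtt{)}\mid\mathtt{(?<!}R\mathtt{)}$$ with $\psi\in\Psi$ and loop bounds $m,n$ satisfying $0\le m\le n\ne0$ with $n$ finite, or $m\geq 0$ finite and $n=\infty$. Convention: $R\{0,0\}=()$; $R\mathtt{*}$ abbreviates $R\{0,\infty\}$. The last four forms (lookahead, lookback, negative lookahead, negative lookback) are called lookarounds. **Reverse of regexes.** $\psi^r=\psi$, $()^r=()$, $(R|S)^r=R^r|S^r$,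 $(R\&S)^r=R^r\&S^r$, $(R\cdot S)^r=S^r\cdot R^r$, $(R\{m,n\})^r=R^r\{m,n\}$, $(\sim R)^r=\sim(R^r)$, $\mathtt{(?=}R\mathtt{)}^r=\mathtt{(?<=}R^r\mathtt{)}$, $\mathtt{(?<=}R\mathtt{)}^r=\mathtt{(?=}R^r\mathtt{)}$, $\mathtt{(?!}R\mathtt{)}^r=\mathtt{(?<!}R^r\mathtt{)}$, $\mathtt{(?<!}R\mathtt{)}^r=\mathtt{(?!}R^r\mathtt{)}$. **Nullability, derivatives, match end** (mutually recursive). For valid $x$: $\mathit{Null}_x(())$ is true; $\mathit{Null}_x(\psi)$ is false; $\mathit{Null}_x(R|R')$ iff $\mathit{Null}_x(R)$ or $\mathit{Null}_x(R')$; $\mathit{Null}_x(R\&R')$ iff $\mathit{Null}_x(R\cdot R')$ iff $\mathit{Null}_x(R)$ and $\mathit{Null}_x(R')$; $\mathit{Null}_x(R\{m,n\})$ iff $m=0$ or $\mathit{Null}_x(R)$; $\mathit{Null}_x(\sim R)$ iff not $\mathit{Null}_x(R)$; $\mathit{Null}_x(\mathtt{(?=}R\mathtt{)})$ iff $\mathit{IsMatch}(x,R)$; $\mathit{Null}_x(\mathtt{(?<=}R\mathtt{)})$ iff $\mathit{IsMatch}(x^r,R^r)$; $\mathit{Null}_x(\mathtt{(?!}R\mathtt{)})$ iff not $\mathit{IsMatch}(x,R)$; $\mathit{Null}_x(\mathtt{(?<!}R\mathtt{)})$ iff not $\mathit{IsMatch}(x^r,R^r)$. $\mathit{Null}_\forall(R)$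 means that $\mathit{Null}_x(R)$ is true for all valid $x$ (in all strings). For valid nonfinal $x=s\langle i\rangle$ the derivative $\partial_x(R)\in\mathcal{R}$ is: $\partial_x(())=\bot$; $\partial_x(\ell)=\bot$ for lookarounds $\ell$; $\partial_{s\langle i\rangle}(\psi)=()$ if $s_i\in[\![\psi]\!]$, else $\bot$; $\partial_x(R|S)=\partial_x(R)|\partial_x(S)$; $\partial_x(R\&S)=\partial_x(R)\&\partial_x(S)$; $\partial_x(\sim R)=\sim\partial_x(R)$; $\partial_x(R\cdot S)=(\partial_x(R)\cdot S)\,|\,\partial_x(S)$ if $\mathit{Null}_x(R)$, else $\partial_x(R)\cdot S$; $\partial_x(R\{m,n\})=\partial_x(R)\cdot R\{m\dot-1,n\dot-1\}$ if $m=0$ or $\mathit{Null}_\forall(R)$ or not $\mathit{Null}_x(R)$, else $\partial_x(R\cdot R\{m\dot-1,n\dot-1\})$. Here $\infty\dot-1=\infty$, $0\dot-1=0$, $k\dot-1=k-1$ for $k>0$. $\mathit{Null}^{\mathsf{fail}}_x(R)=x$ if $\mathit{Null}_x(R)$, else $\mathsf{fail}$. $\mathit{MatchEnd}(x,R)=\mathit{Null}^{\mathsf{fail}}_x(R)$ if $x$ is final, else $\max(\mathit{Null}^{\mathsf{fail}}_x(R),\mathit{MatchEnd}(x+1,\partial_x(R)))$. $\mathit{IsMatch}(x,R)$ iff $\mathit{MatchEnd}(x,R)\ne\mathsf{fail}$. **Derivation relation.** For valid $x$, the set of all match ends is $(x\xrightarrow{R})=N_x(R)$ if $x$ is final, else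 $N_x(R)\cup(x+1\xrightarrow{\partial_x(R)})$, where $N_x(R)=\{x\}$ if $\mathit{Null}_x(R)$ and $\emptyset$ otherwise. Write $x\xrightarrow{R}y$ iff $y\in(x\xrightarrow{R})$. **Match semantics.** $\mathcal{U}=\{\langle s\langle i\rangle,s\langle j\rangle\rangle\mid s\in\Sigma^*,\ 0\le i\le j\le|s|\}$ and $\mathcal{M}(R)=\{\langle x,y\rangle\in\mathcal{U}\mid x\xrightarrow{R}y\}$. *)

theory Defs
  imports "HOL-Library.Extended_Nat"
begin

locale effective_boolean_algebra =
  fixes D :: "'d set"
    and Psi :: "'p set"
    and den :: "'p \<Rightarrow> 'd set"
    and falsum :: 'p
    and verum :: 'p
    and disj :: "'p \<Rightarrow> 'p \<Rightarrow> 'p"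
    and conj :: "'p \<Rightarrow> 'p \<Rightarrow> 'p"
    and neg :: "'p \<Rightarrow> 'p"
  assumes den_subset: "\<phi> \<in> Psi \<Longrightarrow> den \<phi> \<subseteq> D"
    and falsum_closed: "falsum \<in> Psi"
    and verum_closed: "verum \<in> Psi"
    and disj_closed: "\<phi> \<in> Psi \<Longrightarrow> \<psi> \<in> Psi \<Longrightarrow> disj \<phi> \<psi> \<in> Psi"
    and conj_closed: "\<phi> \<in> Psi \<Longrightarrow> \<psi> \<in> Psi \<Longrightarrow> conj \<phi> \<psi> \<in> Psi"
    and neg_closed: "\<phi> \<in> Psi \<Longrightarrow> neg \<phi> \<in> Psi"
    and den_falsum: "den falsum = {}"
    and den_verum: "den verum = D"
    and den_disj: "\<phi> \<in> Psi \<Longrightarrow> \<psi> \<in> Psi \<Longrightarrow> den (disj \<phi> \<psi>) = den \<phi> \<union> den \<psi>"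
    and den_conj: "\<phi> \<in> Psi \<Longrightarrow> \<psi> \<in> Psi \<Longrightarrow> den (conj \<phi> \<psi>) = den \<phi> \<inter> den \<psi>"
    and den_neg: "\<phi> \<in> Psi \<Longrightarrow> den (neg \<phi>) = D - den \<phi>"

text \<open>Locations are string/position pairs; positions range over \<open>int\<close> because \<open>-1\<close> is
  used for failure.\<close>
type_synonym 'c loc = "'c list \<times> int"

definition valid :: "'c loc \<Rightarrow> bool" where
  "valid x \<longleftrightarrow> 0 \<le> snd x \<and> snd x \<le> int (length (fst x))"

definition final :: "'c loc \<Rightarrow> bool" where
  "final x \<longleftrightarrow> snd x = int (length (fst x))"

definition next_loc :: "'c loc \<Rightarrow> 'c loc" where
  "next_loc x = (fst x, snd x + 1)"

definition rev_loc :: "'c loc \<Rightarrow> 'c loc" where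
  "rev_loc x = (rev (fst x), int (length (fst x)) - snd x)"

definition fail :: "'c loc" where
  "fail = ([], -1)"

definition max_loc :: "'c loc \<Rightarrow> 'c loc \<Rightarrow> 'c loc" where
  "max_loc x y =
    (if x = fail then y else if y = fail then x else if snd x < snd y then y else x)"

text \<open>The character at a location; only meaningful at valid nonfinal locations.\<close>
definition char_at :: "'c loc \<Rightarrow> 'c" where
  "char_at x = fst x ! nat (snd x)"


datatype 'p regex =
    Pred 'p
  | Eps
  | Alt "'p regex" "'p regex"
  | And "'p regex" "'p regex"
  | Cat "'p regex" "'p regex"
  | Loop "'p regex" nat enat
  | Compl "'p regex"
  | LookAhead "'p regex"
  | LookBack "'p regex"
  | NegLookAhead "'p regex"
  | NegLookBack "'p regex"

text \<open>The datatype does not restrict predicates and loop bounds; the regexes over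
  the predicate set \<open>Psi\<close> are the following subset.\<close>
inductive_set regexes :: "'p set \<Rightarrow> 'p regex set" for Psi :: "'p set" where
  "\<psi> \<in> Psi \<Longrightarrow> Pred \<psi> \<in> regexes Psi"
| "Eps \<in> regexes Psi"
| "R \<in> regexes Psi \<Longrightarrow> S \<in> regexes Psi \<Longrightarrow> Alt R S \<in> regexes Psi"
| "R \<in> regexes Psi \<Longrightarrow> S \<in> regexes Psi \<Longrightarrow> And R S \<in> regexes Psi"
| "R \<in> regexes Psi \<Longrightarrow> S \<in> regexes Psi \<Longrightarrow> Cat R S \<in> regexes Psi"
| "R \<in> regexes Psi \<Longrightarrow> enat m \<le> n \<Longrightarrow> n \<noteq> 0 \<Longrightarrow> Loop R m n \<in> regexes Psi"
| "R \<in> regexes Psi \<Longrightarrow> Compl R \<in> regexes Psi"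
| "R \<in> regexes Psi \<Longrightarrow> LookAhead R \<in> regexes Psi"
| "R \<in> regexes Psi \<Longrightarrow> LookBack R \<in> regexes Psi"
| "R \<in> regexes Psi \<Longrightarrow> NegLookAhead R \<in> regexes Psi"
| "R \<in> regexes Psi \<Longrightarrow> NegLookBack R \<in> regexes Psi"

text \<open>Bounds \<open>{0,0}\<close> are not a loop but denote the empty regex; they arise when
  the bounds of a loop are decremented.\<close>
definition mk_loop :: "'p regex \<Rightarrow> nat \<Rightarrow> enat \<Rightarrow> 'p regex" where
  "mk_loop R m n = (if m = 0 \<and> n = 0 then Eps else Loop R m n)"

definition Star :: "'p regex \<Rightarrow> 'p regex" where
  "Star R = Loop R 0 \<infinity>"

primrec rev_regex :: "'p regex \<Rightarrow> 'p regex" where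
  "rev_regex (Pred \<psi>) = Pred \<psi>"
| "rev_regex Eps = Eps"
| "rev_regex (Alt R S) = Alt (rev_regex R) (rev_regex S)"
| "rev_regex (And R S) = And (rev_regex R) (rev_regex S)"
| "rev_regex (Cat R S) = Cat (rev_regex S) (rev_regex R)"
| "rev_regex (Loop R m n) = Loop (rev_regex R) m n"
| "rev_regex (Compl R) = Compl (rev_regex R)"
| "rev_regex (LookAhead R) = LookBack (rev_regex R)"
| "rev_regex (LookBack R) = LookAhead (rev_regex R)"
| "rev_regex (NegLookAhead R) = NegLookBack (rev_regex R)"
| "rev_regex (NegLookBack R) = NegLookAhead (rev_regex R)"

text \<open>Termination measures for the mutual recursion below: lookaround nesting depth,
  and a size that decreases when a loop is unrolled once.\<close>
primrec look_depth :: "'p regex \<Rightarrow> nat" where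
  "look_depth (Pred \<psi>) = 0"
| "look_depth Eps = 0"
| "look_depth (Alt R S) = max (look_depth R) (look_depth S)"
| "look_depth (And R S) = max (look_depth R) (look_depth S)"
| "look_depth (Cat R S) = max (look_depth R) (look_depth S)"
| "look_depth (Loop R m n) = look_depth R"
| "look_depth (Compl R) = look_depth R"
| "look_depth (LookAhead R) = Suc (look_depth R)"
| "look_depth (LookBack R) = Suc (look_depth R)"
| "look_depth (NegLookAhead R) = Suc (look_depth R)"
| "look_depth (NegLookBack R) = Suc (look_depth R)"

primrec loop_size :: "'p regex \<Rightarrow> nat" where
  "loop_size (Pred \<psi>) = 1"
| "loop_size Eps = 1"
| "loop_size (Alt R S) = Suc (loop_size R + loop_size S)"
| "loop_size (And R S) = Suc (loop_size R + loop_size S)"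
| "loop_size (Cat R S) = Suc (loop_size R + loop_size S)"
| "loop_size (Loop R m n) = Suc m * (loop_size R + 2)"
| "loop_size (Compl R) = Suc (loop_size R)"
| "loop_size (LookAhead R) = Suc (loop_size R)"
| "loop_size (LookBack R) = Suc (loop_size R)"
| "loop_size (NegLookAhead R) = Suc (loop_size R)"
| "loop_size (NegLookBack R) = Suc (loop_size R)"

lemma look_depth_rev_regex [simp]: "look_depth (rev_regex R) = look_depth R"
  by (induction R) auto

lemma look_depth_mk_loop: "look_depth (mk_loop R m n) \<le> look_depth R"
  by (simp add: mk_loop_def)

lemma loop_size_unroll:
  "m \<noteq> 0 \<Longrightarrow> loop_size (Cat R (mk_loop R (m - 1) n)) < loop_size (Loop R m n')"
  by (cases m) (auto simp: mk_loop_def)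


context
  fixes Chars :: "'c set"
    and den :: "'p \<Rightarrow> 'c set"
    and falsum :: 'p
begin

text \<open>The functions are meant for valid locations (nonfinal ones for \<open>deriv\<close>). The test
  \<open>valid x \<and> \<not> final x\<close> merely makes the recursion over locations total. On \<open>enat\<close>,
  \<open>\<infinity> - 1 = \<infinity>\<close> and \<open>0 - 1 = 0\<close>.\<close>
function null :: "'c loc \<Rightarrow> 'p regex \<Rightarrow> bool"
  and deriv :: "'c loc \<Rightarrow> 'p regex \<Rightarrow> 'p regex"
  and is_match :: "'c loc \<Rightarrow> 'p regex \<Rightarrow> bool"
  and match_end :: "'c loc \<Rightarrow> 'p regex \<Rightarrow> 'c loc"
where
  "null x Eps = True"
| "null x (Pred \<psi>) = False"
| "null x (Alt R S) = (null x R \<or> null x S)"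
| "null x (And R S) = (null x R \<and> null x S)"
| "null x (Cat R S) = (null x R \<and> null x S)"
| "null x (Loop R m n) = (m = 0 \<or> null x R)"
| "null x (Compl R) = (\<not> null x R)"
| "null x (LookAhead R) = is_match x R"
| "null x (LookBack R) = is_match (rev_loc x) (rev_regex R)"
| "null x (NegLookAhead R) = (\<not> is_match x R)"
| "null x (NegLookBack R) = (\<not> is_match (rev_loc x) (rev_regex R))"
| "deriv x Eps = Pred falsum"
| "deriv x (Pred \<psi>) = (if char_at x \<in> den \<psi> then Eps else Pred falsum)"
| "deriv x (Alt R S) = Alt (deriv x R) (deriv x S)"
| "deriv x (And R S) = And (deriv x R) (deriv x S)"
| "deriv x (Cat R S) =
    (if null x R then Alt (Cat (deriv x R) S) (deriv x S) else Cat (deriv x R) S)"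
| "deriv x (Loop R m n) =
    (if m = 0 \<or> (\<forall>y. fst y \<in> lists Chars \<and> valid y \<longrightarrow> null y R) \<or> \<not> null x R
     then Cat (deriv x R) (mk_loop R (m - 1) (n - 1))
     else deriv x (Cat R (mk_loop R (m - 1) (n - 1))))"
| "deriv x (Compl R) = Compl (deriv x R)"
| "deriv x (LookAhead R) = Pred falsum"
| "deriv x (LookBack R) = Pred falsum"
| "deriv x (NegLookAhead R) = Pred falsum"
| "deriv x (NegLookBack R) = Pred falsum"
| "is_match x R = (match_end x R \<noteq> fail)"
| "match_end x R =
    (if valid x \<and> \<not> final x
     then max_loc (if null x R then x else fail) (match_end (next_loc x) (deriv x R))
     else (if null x R then x else fail))"
  by pat_completeness auto

lemma look_depth_deriv:
  "null_deriv_is_match_match_end_dom (Inl (Inr (x, R))) \<Longrightarrow>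
    look_depth (deriv x R) \<le> look_depth R"
proof (induction x R rule: null_deriv_is_match_match_end.pinduct(2)
    [where P = "\<lambda>_ _. True" and R = "\<lambda>_ _. True" and S = "\<lambda>_ _. True"])
  case (17 x R m n)
  show ?case
  proof (cases "m = 0 \<or> (\<forall>y. fst y \<in> lists Chars \<and> valid y \<longrightarrow> null y R) \<or> \<not> null x R")
    case True
    then show ?thesis
      using 17 look_depth_mk_loop[of R "m - 1" "n - 1"] by (simp add: deriv.psimps)
  next
    case False
    then have "look_depth (deriv x (Cat R (mk_loop R (m - 1) (n - 1))))
        \<le> look_depth (Cat R (mk_loop R (m - 1) (n - 1)))"
      using 17 by blast
    moreover have "deriv x (Loop R m n) = deriv x (Cat R (mk_loop R (m - 1) (n - 1)))"
      using False 17(1) by (subst deriv.psimps) auto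
    ultimately show ?thesis
      using look_depth_mk_loop[of R "m - 1" "n - 1"] by simp
  qed
qed (auto simp: deriv.psimps)

termination
proof (relation "measures
    [case_sum (case_sum (\<lambda>(x, R). look_depth R) (\<lambda>(x, R). look_depth R))
       (case_sum (\<lambda>(x, R). look_depth R) (\<lambda>(x, R). look_depth R)),
     case_sum (case_sum (\<lambda>(x, R). 0) (\<lambda>(x, R). 0))
       (case_sum (\<lambda>(x, R). Suc (nat (int (length (fst x)) - snd x)))
         (\<lambda>(x, R). Suc (nat (int (length (fst x)) - snd x)))),
     case_sum (case_sum (\<lambda>(x, R). loop_size R) (\<lambda>(x, R). loop_size R))
       (case_sum (\<lambda>(x, R). 1) (\<lambda>(x, R). 0))]", goal_cases)
  case (25 x R m n)
  from 25(1) have "m \<noteq> 0" by simp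
  then have "loop_size (Cat R (mk_loop R (m - 1) (n - 1))) < loop_size (Loop R m n)"
    by (rule loop_size_unroll)
  moreover have "look_depth (Cat R (mk_loop R (m - 1) (n - 1))) = look_depth (Loop R m n)"
    using look_depth_mk_loop[of R "m - 1" "n - 1"] by simp
  ultimately show ?case
    by (simp del: loop_size.simps look_depth.simps)
next
  case (30 x R)
  have "nat (int (length (fst (next_loc x))) - snd (next_loc x))
      < nat (int (length (fst x)) - snd x)"
    using 30(1) by (auto simp: next_loc_def valid_def final_def)
  moreover have "look_depth (deriv x R) < look_depth R \<or> look_depth (deriv x R) = look_depth R"
    using look_depth_deriv[OF 30(2)] by linarith
  ultimately show ?case
    by auto
qed (auto simp: less_max_iff_disj)

function match_ends :: "'c loc \<Rightarrow> 'p regex \<Rightarrow> 'c loc set" where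
  "match_ends x R =
    (if valid x \<and> \<not> final x
     then (if null x R then {x} else {}) \<union> match_ends (next_loc x) (deriv x R)
     else (if null x R then {x} else {}))"
  by pat_completeness auto
termination
  by (relation "measure (\<lambda>(x, R). nat (int (length (fst x)) - snd x))")
    (auto simp: next_loc_def valid_def final_def)

end

declare match_end.simps [simp del] match_ends.simps [simp del]

definition spans :: "'c set \<Rightarrow> ('c loc \<times> 'c loc) set" where
  "spans Chars =
    {((s, i), (s, j)) | s i j. s \<in> lists Chars \<and> 0 \<le> i \<and> i \<le> j \<and> j \<le> int (length s)}"

definition match_set ::
  "'c set \<Rightarrow> ('p \<Rightarrow> 'c set) \<Rightarrow> 'p \<Rightarrow> 'p regex \<Rightarrow> ('c loc \<times> 'c loc) set" where
  "match_set Chars den falsum R =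
    {(x, y) \<in> spans Chars. y \<in> match_ends Chars den falsum x R}"

end

theory Submission
  imports Defs
begin

text \<open>Nullability and derivatives commute with union, intersection and complement, hence by
  induction on the distance of a location from the end of its string so do the sets of match ends;
  a complement is taken within the valid locations that do not precede the start. For
  \<open>\<top>*\<close>, every derivative contains the alternative \<open>()\<cdot>\<top>*\<close>, which is nullable
  everywhere.\<close>

text \<open>Follows the recursion of \<open>match_ends\<close> in the location alone, so regexes can
  stay arbitrary and the hypothesis applies to several derivatives at once.\<close>

lemma loc_induct [case_names step]:
  assumes "\<And>x. (valid x \<Longrightarrow> \<not> final x \<Longrightarrow> P (next_loc x)) \<Longrightarrow> P x"
  shows "P x"
proof (induction x rule: measure_induct_rule[of "\<lambda>x. nat (int (length (fst x)) - snd x)"])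
  case (less x)
  show ?case
    by (rule assms, rule less.IH) (auto simp: next_loc_def valid_def final_def)
qed

lemma match_ends_Alt:
  "match_ends Chars den falsum x (Alt R S) =
    match_ends Chars den falsum x R \<union> match_ends Chars den falsum x S"
proof (induction x arbitrary: R S rule: loc_induct)
  case (step x)
  then show ?case
    by (subst (1 2 3) match_ends.simps) auto
qed

lemma match_ends_subset:
  assumes "valid x"
  shows "match_ends Chars den falsum x R \<subseteq> {(fst x, j) | j. snd x \<le> j \<and> j \<le> int (length (fst x))}"
  using assms
proof (induction x arbitrary: R rule: loc_induct)
  case (step x)
  have "match_ends Chars den falsum (next_loc x) (deriv Chars den falsum x R)
      \<subseteq> {(fst x, j) | j. snd x \<le> j \<and> j \<le> int (length (fst x))}"
    if "\<not> final x"
    using step.IH[OF step.prems that, of "deriv Chars den falsum x R"] step.prems that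
    by (force simp: next_loc_def valid_def final_def)
  with step.prems show ?case
    by (subst match_ends.simps) (cases x; auto simp: valid_def)
qed

text \<open>Later match ends lie strictly after \<open>x\<close>, so nullability at \<open>x\<close>
  alone decides whether \<open>x\<close> is a match end.\<close>

lemma start_notin_match_ends_next:
  assumes "valid x" "\<not> final x"
  shows "x \<notin> match_ends Chars den falsum (next_loc x) R"
proof -
  have "valid (next_loc x)"
    using assms by (auto simp: next_loc_def valid_def final_def)
  from match_ends_subset[OF this, of Chars den falsum R] show ?thesis
    by (cases x) (auto simp: next_loc_def)
qed

lemma match_ends_And:
  "match_ends Chars den falsum x (And R S) =
    match_ends Chars den falsum x R \<inter> match_ends Chars den falsum x S"
proof (induction x arbitrary: R S rule: loc_induct)
  case (step x)
  then show ?case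
    \<comment> \<open>This removes the cross terms of the intersection, where \<open>x\<close> would
      be an immediate end for one regex and a later end for the other.\<close>
    using start_notin_match_ends_next[of x Chars den falsum]
    by (subst (1 2 3) match_ends.simps) auto
qed

lemma match_ends_Compl:
  assumes "valid x"
  shows "match_ends Chars den falsum x (Compl R) =
    {(fst x, j) | j. snd x \<le> j \<and> j \<le> int (length (fst x))} - match_ends Chars den falsum x R"
  using assms
proof (induction x arbitrary: R rule: loc_induct)
  case (step x)
  show ?case
  proof (cases "final x")
    case True
    \<comment> \<open>At the end of the string \<open>x\<close> is the only candidate end.\<close>
    then show ?thesis
      by (subst (1 2) match_ends.simps) (cases x; auto simp: final_def)
  next
    case False
    let ?d = "deriv Chars den falsum x R"
    \<comment> \<open>The candidate \<open>x\<close> is settled by nullability, the others by the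
      induction hypothesis at \<open>next_loc x\<close>.\<close>
    have split: "{(fst x, j) | j. snd x \<le> j \<and> j \<le> int (length (fst x))} =
        insert x {(fst x, j) | j. snd x + 1 \<le> j \<and> j \<le> int (length (fst x))}"
      using step.prems by (cases x) (auto simp: valid_def)
    have "match_ends Chars den falsum (next_loc x) (Compl ?d) =
        {(fst x, j) | j. snd x + 1 \<le> j \<and> j \<le> int (length (fst x))}
          - match_ends Chars den falsum (next_loc x) ?d"
      using step.IH[OF step.prems False, of ?d] step.prems False
      by (auto simp: next_loc_def valid_def final_def)
    moreover have "x \<notin> {(fst x, j) | j. snd x + 1 \<le> j \<and> j \<le> int (length (fst x))}"
      by (cases x) auto
    ultimately show ?thesis
      using step.prems False start_notin_match_ends_next[OF step.prems False, of Chars den falsum ?d]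
      by (subst (1 2) match_ends.simps) (auto simp: split)
  qed
qed

text \<open>With an empty denotation, \<open>Pred falsum\<close> is its own derivative at every
  location, and it is never nullable.\<close>

lemma match_ends_falsum:
  assumes "den falsum = {}"
  shows "match_ends Chars den falsum x (Pred falsum) = {}"
proof (induction x rule: loc_induct)
  case (step x)
  then show ?case
    using assms by (subst match_ends.simps) auto
qed

text \<open>The induction is on \<open>Cat Eps (Star (Pred verum))\<close> because this regex
  reappears as the right alternative of its own derivative, whereas \<open>Star (Pred verum)\<close>
  does not keep its form.\<close>

lemma match_ends_Eps_Cat_Star:
  assumes "den verum = Chars" "fst x \<in> lists Chars" "valid x"
    and "fst y = fst x" "snd x \<le> snd y" "snd y \<le> int (length (fst y))"
  shows "y \<in> match_ends Chars den falsum x (Cat Eps (Star (Pred verum)))"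
  using assms(2-)
proof (induction x rule: loc_induct)
  case (step x)
  show ?case
  proof (cases "y = x")
    case True
    then show ?thesis
      by (subst match_ends.simps) (simp add: Star_def)
  next
    case False
    with step.prems have less: "snd x < snd y"
      by (auto simp: prod_eq_iff)
    with step.prems have nonfinal: "\<not> final x"
      by (simp add: final_def)
    \<comment> \<open>Hence \<open>Pred verum\<close> has derivative \<open>Eps\<close> at
      \<open>x\<close>.\<close>
    have "char_at x \<in> Chars"
      using step.prems nonfinal
      by (auto simp: char_at_def valid_def final_def in_lists_conv_set)
    moreover have "y \<in> match_ends Chars den falsum (next_loc x) (Cat Eps (Star (Pred verum)))"
      using step less nonfinal by (auto simp: next_loc_def valid_def final_def)
    ultimately show ?thesis
      using assms(1) step.prems(2) nonfinal
      by (subst match_ends.simps) (simp add: Star_def mk_loop_def match_ends_Alt)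
  qed
qed

text \<open>One derivative step leads to the regex of the previous lemma.\<close>

lemma match_ends_Star:
  assumes "den verum = Chars" "fst x \<in> lists Chars" "valid x"
    and "fst y = fst x" "snd x \<le> snd y" "snd y \<le> int (length (fst y))"
  shows "y \<in> match_ends Chars den falsum x (Star (Pred verum))"
proof (cases "y = x")
  case True
  then show ?thesis
    by (subst match_ends.simps) (simp add: Star_def)
next
  case False
  with assms have less: "snd x < snd y"
    by (auto simp: prod_eq_iff)
  with assms have nonfinal: "\<not> final x"
    by (simp add: final_def)
  have "char_at x \<in> Chars"
    using assms nonfinal
    by (auto simp: char_at_def valid_def final_def in_lists_conv_set)
  moreover have "y \<in> match_ends Chars den falsum (next_loc x) (Cat Eps (Star (Pred verum)))"
    using assms less nonfinal
    by (intro match_ends_Eps_Cat_Star) (auto simp: next_loc_def valid_def final_def)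
  ultimately show ?thesis
    using assms(1,3) nonfinal
    by (subst match_ends.simps) (simp add: Star_def mk_loop_def)
qed

theorem corollary1:
  fixes Chars :: "'c set"
    and Psi :: "'p set"
    and den :: "'p \<Rightarrow> 'c set"
    and falsum verum :: 'p
    and disj conj :: "'p \<Rightarrow> 'p \<Rightarrow> 'p"
    and neg :: "'p \<Rightarrow> 'p"
  assumes "effective_boolean_algebra Chars Psi den falsum verum disj conj neg"
  shows "effective_boolean_algebra (spans Chars) (regexes Psi) (match_set Chars den falsum)
    (Pred falsum) (Star (Pred verum)) Alt And Compl"
proof -
  interpret effective_boolean_algebra Chars Psi den falsum verum disj conj neg
    by (fact assms)
  show ?thesis
  proof
    show "Star (Pred verum) \<in> regexes Psi"
      unfolding Star_def by (intro regexes.intros verum_closed) auto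
    show "match_set Chars den falsum (Pred falsum) = {}"
      by (simp add: match_set_def match_ends_falsum den_falsum)
    \<comment> \<open>Inclusion in \<open>spans Chars\<close> is built into
      \<open>match_set\<close>; only the converse needs an argument.\<close>
    show "match_set Chars den falsum (Star (Pred verum)) = spans Chars"
      using den_verum
      by (auto simp: match_set_def spans_def valid_def intro!: match_ends_Star)
    \<comment> \<open>For a pair in \<open>spans Chars\<close> the start is valid and the end is
      among the candidates of \<open>match_ends_Compl\<close>.\<close>
    show "match_set Chars den falsum (Compl R) = spans Chars - match_set Chars den falsum R" for R
      by (auto simp: match_set_def spans_def valid_def match_ends_Compl)
  qed (auto simp: match_set_def match_ends_Alt match_ends_And
      intro: regexes.intros falsum_closed)
qed

end
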